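(* For each $v\in\mathbb{R}$ let $\mathfrak{a}_v:\mathbb{R}\to\mathbb{R}$ be continuously differentiable (and absolutely continuous on every compact interval). Then $\mathfrak{a}=(\mathfrak{a}_v)_{v\in\mathbb{R}}$ is strictly proper (for all random variables) if and only if there is a strictly convex differentiable function $\phi:\mathbb{R}\to\mathbb{R}$ such that for all $v,x\in\mathbb{R}$ $$\mathfrak{a}_v(x)=\mathfrak{a}_v(v)-\bigl[\phi(v)-\phi(x)-(v-x)\phi'(x)\bigr],$$ that is, such that the error score $\mathfrak{s}_v(x):=\mathfrak{a}_v(v)-\mathfrak{a}_v(x)$ satisfies $\mathfrak{s}_v(x)=\phi(v)-\phi(x)-(v-x)\phi'(x)$ for all $v,x\in\mathbb{R}$.
   Context: A random variable is a function $V:\Omega\to\mathbb{R}$ on a non-empty set $\Omega$. A probability with finite support on $\Omega$ is a function $p:\Omega\to[0,1]$ with $p(\omega)>0$ for only finitely many $\omega$ and $\sum_{\omega}p(\omega)=1$. Write $\mathrm{Exp}_p[V]=\sum_{\omega}p(\omega)V(\omega)$ and $\mathrm{Exp}_p[\mathfrak{a}_V(x)]=\sum_{\omega}p(\omega)\,\mathfrak{a}_{V(\omega)}(x)$. The family $\mathfrak{a}$ is strictly proper for $V$ if for every finitely supported probability $p$ on $\Omega$ the function $x\mapsto\mathrm{Exp}_p[\mathfrak{a}_V(x)]$ attains its maximum uniquely at $x=\mathrm{Exp}_p[V]$. Strictly proper for all random variables means strictly proper for every $V:\Omega\to\mathbb{R}$ on every non-empty set $\Omega$. *)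

theory Defs
  imports "HOL-Analysis.Analysis"
begin

text \<open>The sample space is a set \<open>\<Omega>\<close> of elements of a type \<open>'w\<close>. Functions on \<open>\<Omega>\<close> are total functions
  on \<open>'w\<close>, of which only the values on \<open>\<Omega>\<close> are used.\<close>

definition finite_support_prob :: "'w set \<Rightarrow> ('w \<Rightarrow> real) \<Rightarrow> bool" where
  "finite_support_prob \<Omega> p \<longleftrightarrow>
     (\<forall>\<omega>\<in>\<Omega>. 0 \<le> p \<omega> \<and> p \<omega> \<le> 1) \<and>
     finite {\<omega>\<in>\<Omega>. p \<omega> > 0} \<and>
     (\<Sum>\<omega> | \<omega> \<in> \<Omega> \<and> p \<omega> > 0. p \<omega>) = 1"

definition Exp :: "'w set \<Rightarrow> ('w \<Rightarrow> real) \<Rightarrow> ('w \<Rightarrow> real) \<Rightarrow> real" where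
  "Exp \<Omega> p V = (\<Sum>\<omega> | \<omega> \<in> \<Omega> \<and> p \<omega> > 0. p \<omega> * V \<omega>)"

definition strictly_proper_for :: "(real \<Rightarrow> real \<Rightarrow> real) \<Rightarrow> 'w set \<Rightarrow> ('w \<Rightarrow> real) \<Rightarrow> bool" where
  "strictly_proper_for a \<Omega> V \<longleftrightarrow>
     (\<forall>p. finite_support_prob \<Omega> p \<longrightarrow>
        {x. is_arg_max (\<lambda>x. Exp \<Omega> p (\<lambda>\<omega>. a (V \<omega>) x)) (\<lambda>_. True) x} = {Exp \<Omega> p V})"

text \<open>A HOL formula cannot quantify over types, so the type from which the sample spaces are drawn
  is a parameter. Lemma \<open>strictly_proper_universe\<close> below shows that, as soon as this type
  is infinite, strict properness over it implies strict properness over every other type.\<close>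

definition strictly_proper :: "'w itself \<Rightarrow> (real \<Rightarrow> real \<Rightarrow> real) \<Rightarrow> bool" where
  "strictly_proper _ a \<longleftrightarrow>
     (\<forall>(\<Omega> :: 'w set) V. \<Omega> \<noteq> {} \<longrightarrow> strictly_proper_for a \<Omega> V)"

definition error_score :: "(real \<Rightarrow> real \<Rightarrow> real) \<Rightarrow> real \<Rightarrow> real \<Rightarrow> real" where
  "error_score a v x = a v v - a v x"

definition strictly_convex_on :: "'a::real_vector set \<Rightarrow> ('a \<Rightarrow> real) \<Rightarrow> bool" where
  "strictly_convex_on S f \<longleftrightarrow> convex S \<and>
     (\<forall>x\<in>S. \<forall>y\<in>S. x \<noteq> y \<longrightarrow>
        (\<forall>u>0. \<forall>v>0. u + v = 1 \<longrightarrow> f (u *\<^sub>R x + v *\<^sub>R y) < u * f x + v * f y))"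

text \<open>Absolute continuity of a function on \<open>[c, d]\<close>. (The library constant
  \<open>absolutely_continuous\<close> concerns measures.)\<close>

definition absolutely_continuous_on_interval :: "real \<Rightarrow> real \<Rightarrow> (real \<Rightarrow> real) \<Rightarrow> bool" where
  "absolutely_continuous_on_interval c d f \<longleftrightarrow>
     (\<forall>\<epsilon>>0. \<exists>\<delta>>0. \<forall>(n::nat) l r.
        (\<forall>k<n. c \<le> l k \<and> l k \<le> r k \<and> r k \<le> d) \<and>
        (\<forall>j<n. \<forall>k<n. j \<noteq> k \<longrightarrow> {l j<..<r j} \<inter> {l k<..<r k} = {}) \<and>
        (\<Sum>k<n. r k - l k) < \<delta> \<longrightarrow>
        (\<Sum>k<n. \<bar>f (r k) - f (l k)\<bar>) < \<epsilon>)"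

lemma strictly_proper_universe:
  assumes inf: "infinite (UNIV :: 'w set)"
    and sp: "strictly_proper TYPE('w) a"
  shows "strictly_proper TYPE('v) a"
  unfolding strictly_proper_def strictly_proper_for_def
proof (intro allI impI)
  fix \<Omega> :: "'v set" and V p
  assume p: "finite_support_prob \<Omega> p"
  define S where "S = {\<omega>\<in>\<Omega>. p \<omega> > 0}"
  have S: "finite S" "sum p S = 1" "\<forall>\<omega>\<in>S. 0 < p \<omega> \<and> p \<omega> \<le> 1"
    using p unfolding finite_support_prob_def S_def by auto
  obtain T :: "'w set" where T: "finite T" "card T = card S"
    using infinite_arbitrarily_large[OF inf] by blast
  then obtain g where g: "bij_betw g T S"
    using S(1) finite_same_card_bij by blast
  have supp: "{\<omega>\<in>T. p (g \<omega>) > 0} = T"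
    using g S(3) by (auto simp: bij_betw_def)
  have sumeq: "(\<Sum>\<omega>\<in>T. h (g \<omega>)) = sum h S" for h :: "'v \<Rightarrow> real"
    by (rule sum.reindex_bij_betw[OF g])
  have E: "Exp T (p \<circ> g) (\<lambda>\<omega>. W (g \<omega>)) = Exp \<Omega> p W" for W
    unfolding Exp_def comp_def supp S_def[symmetric] by (rule sumeq)
  have "\<forall>\<omega>\<in>T. 0 < p (g \<omega>) \<and> p (g \<omega>) \<le> 1"
    using g S(3) by (auto simp: bij_betw_def)
  hence "finite_support_prob T (p \<circ> g)"
    unfolding finite_support_prob_def comp_def supp using T(1) S(2) sumeq[of p]
    by (auto simp: less_imp_le)
  moreover have "T \<noteq> {}" using S(2) T(2) by (metis card_0_eq S(1) card.empty sum.empty zero_neq_one)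
  then have "strictly_proper_for a T (\<lambda>\<omega>. V (g \<omega>))"
    using sp unfolding strictly_proper_def by simp
  ultimately have "{x. is_arg_max (\<lambda>x. Exp T (p \<circ> g) (\<lambda>\<omega>. a (V (g \<omega>)) x)) (\<lambda>_. True) x}
      = {Exp T (p \<circ> g) (\<lambda>\<omega>. V (g \<omega>))}"
    unfolding strictly_proper_for_def by simp
  then show "{x. is_arg_max (\<lambda>x. Exp \<Omega> p (\<lambda>\<omega>. a (V \<omega>) x)) (\<lambda>_. True) x} = {Exp \<Omega> p V}"
    unfolding E[of V] E[of "\<lambda>\<omega>. a (V \<omega>) x" for x] .
qed

end

theory Submission
  imports Defs
begin

text \<open>For two values \<open>v \<noteq> w\<close> with weights of mean \<open>x\<close>, stationarity of the expected score at \<open>x\<close> reads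
  \<open>(w - x) a\<^sub>v'(x) + (x - v) a\<^sub>w'(x) = 0\<close>, so \<open>a\<^sub>v'(x) = (v - x) c(x)\<close> with \<open>c = a\<^sub>1' - a\<^sub>0'\<close>. The function
  \<open>\<phi>(x) = (1 - x) a\<^sub>0(x) + x a\<^sub>1(x)\<close>, the expected score of a Bernoulli variable of mean \<open>x\<close>, then has
  derivative \<open>a\<^sub>1 - a\<^sub>0\<close>, and \<open>a\<^sub>v(x)\<close> and \<open>\<phi>(x) + (v - x) \<phi>'(x)\<close> have the same derivative in \<open>x\<close>. Strict
  convexity of \<open>\<phi>\<close> is strict properness for constant variables. Conversely, the Bregman form makes the
  expected score a constant plus \<open>\<phi>(x) + (m - x) \<phi>'(x)\<close>, where \<open>m\<close> is the mean: the value at \<open>m\<close> of the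
  tangent at \<open>x\<close>, which strict convexity makes less than \<open>\<phi>(m)\<close> for \<open>x \<noteq> m\<close>.\<close>

lemma unique_arg_max_iff:
  fixes f :: "'b \<Rightarrow> 'c::linorder"
  shows "{x. is_arg_max f (\<lambda>_. True) x} = {m} \<longleftrightarrow> (\<forall>x. x \<noteq> m \<longrightarrow> f x < f m)"
proof
  assume *: "{x. is_arg_max f (\<lambda>_. True) x} = {m}"
  show "\<forall>x. x \<noteq> m \<longrightarrow> f x < f m"
  proof (intro allI impI, rule ccontr)
    fix x assume "x \<noteq> m" "\<not> f x < f m"
    moreover have "is_arg_max f (\<lambda>_. True) m" using * by blast
    \<comment> \<open>By linearity \<open>f m \<le> f x\<close>, so a value above \<open>f x\<close>
      would also lie above \<open>f m\<close>.\<close>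
    ultimately have "is_arg_max f (\<lambda>_. True) x"
      unfolding is_arg_max_def by (meson dual_order.strict_trans2 not_less)
    with * \<open>x \<noteq> m\<close> show False by blast
  qed
next
  assume *: "\<forall>x. x \<noteq> m \<longrightarrow> f x < f m"
  show "{x. is_arg_max f (\<lambda>_. True) x} = {m}"
    unfolding is_arg_max_def using * by (auto dest: order.asym)
qed

text \<open>The sample space \<open>bool\<close> carries every variable with at most two values. The
  weights 0 and 1 are allowed, so constant variables are covered too.\<close>

lemma strictly_proper_two_point:
  assumes sp: "strictly_proper TYPE(bool) a" and u: "0 \<le> u" "u \<le> 1"
    and x: "x \<noteq> (1 - u) * v + u * w"
  shows "(1 - u) * a v x + u * a w x
    < (1 - u) * a v ((1 - u) * v + u * w) + u * a w ((1 - u) * v + u * w)"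
proof -
  define p where "p = (\<lambda>b. if b then u else 1 - u)"
  define V where "V = (\<lambda>b. if b then w else v)"
  have sum: "(\<Sum>b | b \<in> UNIV \<and> p b > 0. p b * W b) = (1 - u) * W False + u * W True"
    for W :: "bool \<Rightarrow> real"
  proof -
    \<comment> \<open>If \<open>u\<close> is 0 or 1, one point leaves the support, but its term is
      zero anyway.\<close>
    have "(\<Sum>b | b \<in> UNIV \<and> p b > 0. p b * W b) = (\<Sum>b\<in>UNIV. p b * W b)"
      using u by (intro sum.mono_neutral_left) (auto simp: p_def split: if_splits)
    then show ?thesis by (simp add: UNIV_bool p_def)
  qed
  have "finite_support_prob UNIV p"
    using u sum[of "\<lambda>_. 1"] by (auto simp: finite_support_prob_def p_def)
  then have "{x. is_arg_max (\<lambda>x. Exp UNIV p (\<lambda>b. a (V b) x)) (\<lambda>_. True) x} = {Exp UNIV p V}"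
    using sp unfolding strictly_proper_def strictly_proper_for_def by blast
  then show ?thesis
    using x unfolding unique_arg_max_iff Exp_def sum by (simp add: V_def)
qed

lemma strictly_proper_point:
  assumes "strictly_proper TYPE(bool) a" "x \<noteq> v"
  shows "a v x < a v v"
  using strictly_proper_two_point[OF assms(1), of 0 x v v] assms(2) by simp

text \<open>The weights are chosen to make \<open>x\<close> the mean, hence a maximum of a
  differentiable function. The cases \<open>x = v\<close> and \<open>x = w\<close> are degenerate
  distributions.\<close>

lemma strictly_proper_stationary:
  assumes sp: "strictly_proper TYPE(bool) a"
    and D: "\<And>v x. (a v has_real_derivative b v x) (at x)"
    and x: "v \<le> x" "x \<le> w" "v < w"
  shows "(w - x) * b v x + (x - v) * b w x = 0"
proof -
  define u where "u = (x - v) / (w - v)"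
  have u: "0 \<le> u" "u \<le> 1" and u': "1 - u = (w - x) / (w - v)"
    using x by (auto simp: u_def field_simps)
  have m: "(1 - u) * v + u * w = x"
    using x unfolding u' u_def by (simp add: divide_simps) (simp add: algebra_simps)
  have "((\<lambda>y. (1 - u) * a v y + u * a w y) has_real_derivative
      (1 - u) * b v x + u * b w x) (at x)"
    by (intro DERIV_add DERIV_cmult D)
  moreover have "(1 - u) * a v y + u * a w y \<le> (1 - u) * a v x + u * a w x" for y
    using strictly_proper_two_point[OF sp u, of y v w] m by (cases "y = x") auto
  ultimately have "(1 - u) * b v x + u * b w x = 0"
    by (intro DERIV_local_max[where d = 1]) auto
  then show ?thesis
    using x unfolding u' u_def by (simp add: divide_simps)
qed

lemma strictly_proper_derivative:
  assumes sp: "strictly_proper TYPE(bool) a"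
    and D: "\<And>v x. (a v has_real_derivative b v x) (at x)"
  shows "b v x = (v - x) * (b 1 x - b 0 x)"
proof -
  have b0: "b x x = 0" for x
    using strictly_proper_stationary[OF sp D, of x x "x + 1"] by simp
  have two_sided: "b v x * (w - x) = b w x * (v - x)" if "v < x" "x < w" for v w
    using strictly_proper_stationary[OF sp D, of v x w] that by (simp add: algebra_simps)
  \<comment> \<open>\<open>c\<close> is the quotient of \<open>b v x\<close> by \<open>v - x\<close>
    at the reference point \<open>v = x + 1\<close>. Stationarity compares only points on opposite
    sides of \<open>x\<close>: those on the left are compared with \<open>x + 1\<close>, those on
    the right with \<open>x - 1\<close>, whose quotient is already known to be
    \<open>c\<close>.\<close>
  define c where "c = b (x + 1) x"
  have left: "b v x = (v - x) * c" if "v < x" for v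
    using two_sided[of v "x + 1"] that by (simp add: c_def)
  have right: "b v x = (v - x) * c" if "x < v" for v
    using two_sided[of "x - 1" v] left[of "x - 1"] that by (simp add: algebra_simps)
  have "b v x = (v - x) * c" for v
    using left[of v] right[of v] b0[of x] by (cases v x rule: linorder_cases) auto
  \<comment> \<open>Subtracting the instances at 0 and 1 identifies \<open>c\<close> as
    \<open>b 1 x - b 0 x\<close>.\<close>
  from this[of v] this[of 0] this[of 1] show ?thesis by (simp add: algebra_simps)
qed

text \<open>A strict supporting line at the intermediate point \<open>z\<close>, evaluated at
  \<open>x\<close> and \<open>y\<close> and averaged, gives the claim: the slope terms cancel
  because \<open>z\<close> is the weighted mean.\<close>

lemma strictly_convex_on_UNIV_if_above_tangents:
  fixes \<phi> g :: "real \<Rightarrow> real"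
  assumes tangent: "\<And>x y. x \<noteq> y \<Longrightarrow> \<phi> x + (y - x) * g x < \<phi> y"
  shows "strictly_convex_on UNIV \<phi>"
  unfolding strictly_convex_on_def
proof (intro conjI ballI impI allI)
  fix x y u v :: real
  assume "x \<noteq> y" and u: "0 < u" and v: "0 < v" and uv: "u + v = 1"
  define z where "z = u *\<^sub>R x + v *\<^sub>R y"
  have v': "v = 1 - u" using uv by simp
  have zx: "x - z = v * (x - y)" and zy: "y - z = u * (y - x)"
    unfolding z_def v' by (simp_all add: algebra_simps)
  with u v \<open>x \<noteq> y\<close> have "z \<noteq> x" "z \<noteq> y" by auto
  then have "u * (\<phi> z + (x - z) * g z) + v * (\<phi> z + (y - z) * g z) < u * \<phi> x + v * \<phi> y"
    using tangent[of z x] tangent[of z y] u v by (intro add_strict_mono mult_strict_left_mono) auto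
  moreover have "u * (\<phi> z + (x - z) * g z) + v * (\<phi> z + (y - z) * g z) = \<phi> z"
    unfolding zx zy v' by (simp add: algebra_simps)
  ultimately show "\<phi> (u *\<^sub>R x + v *\<^sub>R y) < u * \<phi> x + v * \<phi> y"
    by (simp add: z_def)
qed simp

lemma strictly_convex_on_imp_convex_on:
  assumes "strictly_convex_on S f"
  shows "convex_on S f"
proof (rule convex_onI)
  fix t :: real and x y
  assume t: "0 < t" "t < 1" and S: "x \<in> S" "y \<in> S"
  show "f ((1 - t) *\<^sub>R x + t *\<^sub>R y) \<le> (1 - t) * f x + t * f y"
  proof (cases "x = y")
    case True
    then show ?thesis by (simp flip: scaleR_left_distrib distrib_right)
  next
    case False
    have "f ((1 - t) *\<^sub>R x + t *\<^sub>R y) < (1 - t) * f x + t * f y"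
      using assms S t False unfolding strictly_convex_on_def by auto
    then show ?thesis by simp
  qed
qed (use assms in \<open>simp add: strictly_convex_on_def\<close>)

text \<open>Convexity alone gives the weak inequality. Using it at the midpoint of \<open>x\<close>
  and \<open>y\<close>, where strict convexity puts the graph below the chord, makes it strict at
  \<open>y\<close>.\<close>

lemma strictly_convex_above_tangent:
  fixes \<phi> :: "real \<Rightarrow> real"
  assumes sc: "strictly_convex_on UNIV \<phi>"
    and D: "(\<phi> has_real_derivative d) (at x)" and "x \<noteq> y"
  shows "\<phi> x + (y - x) * d < \<phi> y"
proof -
  define z where "z = (x + y) / 2"
  define e where "e = (y - x) * d"
  have "d * (z - x) = e / 2"
    by (simp add: z_def e_def field_simps)
  then have "\<phi> z - \<phi> x \<ge> e / 2"
    using convex_on_imp_above_tangent[OF strictly_convex_on_imp_convex_on[OF sc],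
        where c = x and x = z and f' = d] D
    by simp
  moreover have "\<phi> ((1/2) *\<^sub>R x + (1/2) *\<^sub>R y) < 1/2 * \<phi> x + 1/2 * \<phi> y"
    using sc \<open>x \<noteq> y\<close> unfolding strictly_convex_on_def
    by (metis UNIV_I field_sum_of_halves half_gt_zero_iff zero_less_one)
  then have "\<phi> z < (\<phi> x + \<phi> y) / 2"
    by (simp add: z_def add_divide_distrib)
  ultimately show ?thesis unfolding e_def[symmetric] by (simp add: field_simps)
qed

lemma Bregman_score_strictly_proper_for:
  fixes a :: "real \<Rightarrow> real \<Rightarrow> real" and V :: "'w \<Rightarrow> real"
  assumes sc: "strictly_convex_on UNIV \<phi>"
    and D: "\<And>x. (\<phi> has_real_derivative g x) (at x)"
    and a: "\<And>v x. a v x = a v v - (\<phi> v - \<phi> x - (v - x) * g x)"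
  shows "strictly_proper_for a \<Omega> V"
  unfolding strictly_proper_for_def unique_arg_max_iff
proof (intro allI impI)
  fix p x assume p: "finite_support_prob \<Omega> p" and x: "x \<noteq> Exp \<Omega> p V"
  define S where "S = {\<omega>\<in>\<Omega>. p \<omega> > 0}"
  define m where "m = Exp \<Omega> p V"
  \<comment> \<open>\<open>C\<close> collects the part of the expected score that does not depend on
    the report.\<close>
  define C where "C = (\<Sum>\<omega>\<in>S. p \<omega> * (a (V \<omega>) (V \<omega>) - \<phi> (V \<omega>)))"
  have 1: "sum p S = 1"
    using p by (simp add: finite_support_prob_def S_def)
  have m: "m = (\<Sum>\<omega>\<in>S. p \<omega> * V \<omega>)"
    by (simp add: m_def Exp_def S_def)
  have E: "Exp \<Omega> p (\<lambda>\<omega>. a (V \<omega>) y) = C + \<phi> y + (m - y) * g y" for y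
  proof -
    have "Exp \<Omega> p (\<lambda>\<omega>. a (V \<omega>) y) = (\<Sum>\<omega>\<in>S. p \<omega> * (a (V \<omega>) (V \<omega>) - \<phi> (V \<omega>))
        + p \<omega> * (\<phi> y - y * g y) + p \<omega> * V \<omega> * g y)"
      unfolding Exp_def S_def by (intro sum.cong refl, subst a) (simp add: algebra_simps)
    also have "\<dots> = C + sum p S * (\<phi> y - y * g y) + m * g y"
      by (simp add: sum.distrib C_def m flip: sum_distrib_right)
    finally show ?thesis by (simp add: 1 algebra_simps)
  qed
  show "Exp \<Omega> p (\<lambda>\<omega>. a (V \<omega>) x) < Exp \<Omega> p (\<lambda>\<omega>. a (V \<omega>) (Exp \<Omega> p V))"
    unfolding E using strictly_convex_above_tangent[OF sc D, of x m] x by (simp add: m_def)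
qed

lemma strictly_proper_imp_Bregman:
  fixes a :: "real \<Rightarrow> real \<Rightarrow> real"
  assumes sp: "strictly_proper TYPE(bool) a"
    and D: "\<And>v x. (a v has_real_derivative b v x) (at x)"
  obtains \<phi> g where "\<And>x. (\<phi> has_real_derivative g x) (at x)"
    and "\<And>v x. a v x = a v v - (\<phi> v - \<phi> x - (v - x) * g x)"
    and "strictly_convex_on UNIV \<phi>"
proof
  define \<phi> where "\<phi> = (\<lambda>x. (1 - x) * a 0 x + x * a 1 x)"
  define g where "g = (\<lambda>x. a 1 x - a 0 x)"
  note b = strictly_proper_derivative[OF sp D]
  show D\<phi>: "(\<phi> has_real_derivative g x) (at x)" for x
  proof -
    have "(\<phi> has_real_derivative
        ((0 - 1) * a 0 x + b 0 x * (1 - x)) + (1 * a 1 x + b 1 x * x)) (at x)"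
      unfolding \<phi>_def by (intro DERIV_add DERIV_mult DERIV_diff DERIV_const DERIV_ident D)
    \<comment> \<open>By \<open>b\<close>, the two terms with derivatives of the scores are
      \<open>-x * (1 - x)\<close> and \<open>x * (1 - x)\<close> times the same factor, so they
      cancel.\<close>
    then show ?thesis
      by (rule DERIV_cong) (subst b[of 0], subst b[of 1], simp add: g_def algebra_simps)
  qed
  show bregman: "a v x = a v v - (\<phi> v - \<phi> x - (v - x) * g x)" for v x
  proof -
    \<comment> \<open>\<open>h\<close> subtracts from the score the value at \<open>v\<close> of the
      tangent to \<open>\<phi>\<close> at \<open>x\<close>. For \<open>x = v\<close> that value is
      \<open>\<phi> v\<close>, so constancy of \<open>h\<close> is the claim.\<close>
    define h where "h = (\<lambda>x. a v x - (\<phi> x + (v - x) * g x))"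
    have "(h has_real_derivative
        b v x - (g x + ((0 - 1) * g x + (b 1 x - b 0 x) * (v - x)))) (at x)" for x
      unfolding h_def g_def
      by (intro DERIV_diff DERIV_add DERIV_mult DERIV_const DERIV_ident D D\<phi>[unfolded g_def])
    then have "(h has_real_derivative 0) (at x)" for x
      by (rule DERIV_cong) (subst b[of v], simp add: algebra_simps)
    then have "h x = h v" by (intro DERIV_isconst_all allI)
    then show ?thesis by (simp add: h_def)
  qed
  show "strictly_convex_on UNIV \<phi>"
  proof (rule strictly_convex_on_UNIV_if_above_tangents)
    fix x y :: real assume "x \<noteq> y"
    \<comment> \<open>The gap between \<open>\<phi> y\<close> and the tangent is
      \<open>a y y - a y x\<close>, positive by properness for the constant
      \<open>y\<close>.\<close>
    then show "\<phi> x + (y - x) * g x < \<phi> y"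
      using strictly_proper_point[OF sp, of x y] bregman[of y x] by simp
  qed
qed

theorem mainTheorem2:
  fixes a :: "real \<Rightarrow> real \<Rightarrow> real"
  assumes "infinite (UNIV :: 'w set)"
    and "\<And>v. a v C1_differentiable_on UNIV"
    and "\<And>v c d. absolutely_continuous_on_interval c d (a v)"
  shows "strictly_proper TYPE('w) a \<longleftrightarrow>
    (\<exists>\<phi> :: real \<Rightarrow> real.
       strictly_convex_on UNIV \<phi> \<and> \<phi> differentiable_on UNIV \<and>
       (\<forall>v x. a v x = a v v - (\<phi> v - \<phi> x - (v - x) * deriv \<phi> x)) \<and>
       (\<forall>v x. error_score a v x = \<phi> v - \<phi> x - (v - x) * deriv \<phi> x))"
proof
  assume "strictly_proper TYPE('w) a"
  \<comment> \<open>Two-valued variables determine \<open>\<phi>\<close>, so the two-element sample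
    space is enough here.\<close>
  then have sp: "strictly_proper TYPE(bool) a"
    by (rule strictly_proper_universe[OF assms(1)])
  have "\<forall>v. \<exists>D. \<forall>x. (a v has_real_derivative D x) (at x)"
    using assms(2) unfolding C1_differentiable_on_def has_real_derivative_iff_has_vector_derivative
    by (metis UNIV_I)
  then obtain b where b: "\<And>v x. (a v has_real_derivative b v x) (at x)"
    by metis
  obtain \<phi> g where *: "\<And>x. (\<phi> has_real_derivative g x) (at x)"
      "\<And>v x. a v x = a v v - (\<phi> v - \<phi> x - (v - x) * g x)"
      "strictly_convex_on UNIV \<phi>"
    using strictly_proper_imp_Bregman[OF sp b] by metis
  have "\<phi> differentiable_on UNIV"
    using *(1) by (meson differentiable_on_def has_field_derivative_at_within real_differentiable_def)
  moreover have bregman: "a v x = a v v - (\<phi> v - \<phi> x - (v - x) * deriv \<phi> x)" for v x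
    unfolding DERIV_imp_deriv[OF *(1)] by (rule *(2))
  moreover have "error_score a v x = \<phi> v - \<phi> x - (v - x) * deriv \<phi> x" for v x
    using bregman[of v x] by (simp add: error_score_def)
  ultimately show "\<exists>\<phi> :: real \<Rightarrow> real.
       strictly_convex_on UNIV \<phi> \<and> \<phi> differentiable_on UNIV \<and>
       (\<forall>v x. a v x = a v v - (\<phi> v - \<phi> x - (v - x) * deriv \<phi> x)) \<and>
       (\<forall>v x. error_score a v x = \<phi> v - \<phi> x - (v - x) * deriv \<phi> x)"
    using *(3) by blast
next
  assume "\<exists>\<phi> :: real \<Rightarrow> real.
       strictly_convex_on UNIV \<phi> \<and> \<phi> differentiable_on UNIV \<and>
       (\<forall>v x. a v x = a v v - (\<phi> v - \<phi> x - (v - x) * deriv \<phi> x)) \<and>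
       (\<forall>v x. error_score a v x = \<phi> v - \<phi> x - (v - x) * deriv \<phi> x)"
  then obtain \<phi> :: "real \<Rightarrow> real" where sc: "strictly_convex_on UNIV \<phi>"
    and diff: "\<phi> differentiable_on UNIV"
    and a: "\<And>v x. a v x = a v v - (\<phi> v - \<phi> x - (v - x) * deriv \<phi> x)"
    by blast
  have "(\<phi> has_real_derivative deriv \<phi> x) (at x)" for x
    using diff by (simp add: differentiable_on_def DERIV_deriv_iff_real_differentiable)
  then show "strictly_proper TYPE('w) a"
    unfolding strictly_proper_def using Bregman_score_strictly_proper_for[OF sc _ a] by blast
qed

end
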